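(* Let $p > 2$ be an odd integer. Then the real initial value problem $s' = c^{p-1}$, $c' = -s^{p-1}$, $s(0)=0$, $c(0)=1$ has a solution pair $(s,c)$ on the interval $(-B_p, A_p+B_p)$, and this interval is its maximal domain (the solution pair does not extend to a solution pair on any strictly larger interval).
   Context: A solution pair of the real initial value problem on an interval $I$ containing $0$ is a pair of real-valued differentiable functions on $I$ (with one-sided derivatives at any endpoints of $I$ that belong to $I$) satisfying the differential equations on $I$ and the initial conditions at $0$. For an integer $p>2$, $A_p := \int_0^1 \frac{d\xi}{(1-\xi^p)^{1-1/p}}$ and $B_p := \int_0^\infty \frac{d\eta}{(1+\eta^p)^{1-1/p}}$ (both integrals converge). *)

theory Defs
  imports "HOL-Analysis.Analysis"
begin

(* The integrand is unbounded as x tends to 1; at x = 1 itself it takes the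
   value 1 / 0 = 0, which does not affect the integral. *)
definition A_const :: "nat \<Rightarrow> real" where
  "A_const p = integral {0..1} (\<lambda>x. 1 / (1 - x ^ p) powr (1 - 1 / real p))"

definition B_const :: "nat \<Rightarrow> real" where
  "B_const p = integral {0..} (\<lambda>x. 1 / (1 + x ^ p) powr (1 - 1 / real p))"

(* Differentiability is taken within I, so it is two-sided at interior points
   of I and one-sided at any endpoint belonging to I. *)
definition solution_pair ::
  "nat \<Rightarrow> real set \<Rightarrow> (real \<Rightarrow> real) \<Rightarrow> (real \<Rightarrow> real) \<Rightarrow> bool" where
  "solution_pair p I s c \<longleftrightarrow>
     is_interval I \<and> 0 \<in> I \<and>
     (\<forall>t\<in>I. (s has_real_derivative c t ^ (p - 1)) (at t within I)) \<and>
     (\<forall>t\<in>I. (c has_real_derivative - (s t ^ (p - 1))) (at t within I)) \<and>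
     s 0 = 0 \<and> c 0 = 1"

(* The functions are total, so only their values on I and J matter. *)
definition extends_to ::
  "nat \<Rightarrow> real set \<Rightarrow> (real \<Rightarrow> real) \<Rightarrow> (real \<Rightarrow> real) \<Rightarrow> real set \<Rightarrow> bool" where
  "extends_to p I s c J \<longleftrightarrow>
     (\<exists>s' c'. solution_pair p J s' c' \<and> (\<forall>t\<in>I. s' t = s t \<and> c' t = c t))"

end

(* Parametrise the branch of s^p + c^p = 1 through (0, 1) by the polar angle \<theta>,
   which runs over (-pi/4, 3 pi/4) because p is odd. Along a solution
   s' c - s c' = c^p + s^p = 1, so time and angle are related by dt/d\<theta> = r^2, where
   r = (sin^p + cos^p)^(-1/p), and the solution is the inverse of the time map t = T(\<theta>).
   The substitutions x = -c on (pi/2, 3 pi/4) and x = s on (0, pi/2) turn the integral of r^2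
   into B_p and A_p, and the reflection \<theta> -> pi/2 - \<theta> handles (-pi/4, 0). Since s and c
   are unbounded at the ends of the angular range, no solution on a larger interval exists. *)
theory Submission
  imports Defs
begin

locale odd_exponent =
  fixes p :: nat
  assumes p_gt_2: "p > 2" and odd_p: "odd p"
begin

section \<open>Polar description of the curve \<open>s ^ p + c ^ p = 1\<close>\<close>

definition polar_sum :: "real \<Rightarrow> real" where
  "polar_sum \<theta> = sin \<theta> ^ p + cos \<theta> ^ p"

text \<open>Where \<open>polar_sum\<close> is positive, this is the distance from the origin to the
  curve in the direction \<open>\<theta>\<close>, the angle being measured from the c axis towards
  the s axis.\<close>

definition radius :: "real \<Rightarrow> real" where
  "radius \<theta> = polar_sum \<theta> powr (- 1 / real p)"

text \<open>Depends on the polar angle, not on time; the first component of the solution is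
  \<open>sin_p \<circ> angle\<close>, with \<open>angle\<close> the inverse of the time map.\<close>

definition sin_p :: "real \<Rightarrow> real" where
  "sin_p \<theta> = radius \<theta> * sin \<theta>"

definition cos_p :: "real \<Rightarrow> real" where
  "cos_p \<theta> = radius \<theta> * cos \<theta>"

lemma even_p_minus_1: "even (p - 1)"
  using p_gt_2 odd_p by simp

lemma power_p: "x ^ p = x * x ^ (p - 1)" for x :: real
  using p_gt_2 by (cases p) auto

lemma sin_135: "sin (3 * pi / 4) = sqrt 2 / 2"
  using sin_pi_minus[of "pi / 4"] by (simp add: sin_45 field_simps)

lemma cos_135: "cos (3 * pi / 4) = - (sqrt 2 / 2)"
  using cos_pi_minus[of "pi / 4"] by (simp add: cos_45 field_simps)

text \<open>On this range \<open>\<theta> + pi / 4\<close> lies between 0 and \<open>pi\<close>, so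
  its sine, a positive multiple of \<open>sin \<theta> + cos \<theta>\<close>, is positive. Odd
  powers preserve the resulting inequality \<open>- cos \<theta> < sin \<theta>\<close>.\<close>

lemma polar_sum_pos:
  assumes "- (pi / 4) < \<theta>" "\<theta> < 3 * pi / 4"
  shows "polar_sum \<theta> > 0"
proof -
  have "0 < sin (\<theta> + pi / 4)"
    using assms by (intro sin_gt_zero) auto
  then have "0 < (sin \<theta> + cos \<theta>) * (sqrt 2 / 2)"
    by (simp add: sin_add sin_45 cos_45 algebra_simps)
  then have "0 < sin \<theta> + cos \<theta>"
    by (simp add: zero_less_mult_iff)
  \<comment> \<open>An odd root undoes the odd power for negative arguments too, so the inequality
    of the bases passes to the powers whatever their signs.\<close>
  then have "root p ((- cos \<theta>) ^ p) < root p (sin \<theta> ^ p)"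
    unfolding odd_real_root_power_cancel[OF odd_p] by simp
  then have "(- cos \<theta>) ^ p < sin \<theta> ^ p"
    using p_gt_2 by simp
  then show ?thesis using odd_p by (simp add: polar_sum_def)
qed

lemma radius_pos:
  assumes "- (pi / 4) < \<theta>" "\<theta> < 3 * pi / 4"
  shows "radius \<theta> > 0"
  using polar_sum_pos[OF assms] by (simp add: radius_def)

lemma radius_power_mult_polar_sum:
  assumes "- (pi / 4) < \<theta>" "\<theta> < 3 * pi / 4"
  shows "radius \<theta> ^ p * polar_sum \<theta> = 1"
proof -
  have "radius \<theta> ^ p = polar_sum \<theta> powr - 1"
    using polar_sum_pos[OF assms] p_gt_2
    by (simp add: radius_def powr_realpow[symmetric] powr_powr)
  then show ?thesis
    using polar_sum_pos[OF assms] by (simp add: powr_minus)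
qed

lemma sin_p_cos_p_power:
  assumes "- (pi / 4) < \<theta>" "\<theta> < 3 * pi / 4"
  shows "sin_p \<theta> ^ p + cos_p \<theta> ^ p = 1"
  using radius_power_mult_polar_sum[OF assms]
  by (simp add: sin_p_def cos_p_def polar_sum_def power_mult_distrib algebra_simps)

lemma DERIV_radius:
  assumes "- (pi / 4) < \<theta>" "\<theta> < 3 * pi / 4"
  shows "(radius has_real_derivative
    radius \<theta> ^ (p + 1) * (cos \<theta> ^ (p - 1) * sin \<theta> - sin \<theta> ^ (p - 1) * cos \<theta>)) (at \<theta>)"
proof -
  note pos = polar_sum_pos[OF assms]
  have d: "(polar_sum has_real_derivative
      real p * (sin \<theta> ^ (p - 1) * cos \<theta> - cos \<theta> ^ (p - 1) * sin \<theta>)) (at \<theta>)"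
    unfolding polar_sum_def[abs_def]
    by (auto intro!: derivative_eq_intros simp: algebra_simps)
  \<comment> \<open>The exponent left by the power rule is \<open>p + 1\<close> times
    \<open>- 1 / real p\<close>, which turns this factor back into a natural power of the
    radius.\<close>
  have e: "polar_sum \<theta> powr (- 1 / real p - 1) = radius \<theta> ^ (p + 1)"
  proof -
    have "radius \<theta> ^ (p + 1) = polar_sum \<theta> powr (- 1 / real p * real (p + 1))"
      using pos radius_pos[OF assms]
      by (subst powr_realpow[symmetric]) (auto simp: radius_def powr_powr)
    also have "- 1 / real p * real (p + 1) = - 1 / real p - 1"
      using p_gt_2 by (simp add: field_simps)
    finally show ?thesis by simp
  qed
  have "((\<lambda>x. polar_sum x powr (- 1 / real p)) has_real_derivative
      (- 1 / real p) * polar_sum \<theta> powr (- 1 / real p - 1) *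
      (real p * (sin \<theta> ^ (p - 1) * cos \<theta> - cos \<theta> ^ (p - 1) * sin \<theta>))) (at \<theta>)"
    using DERIV_fun_powr[OF d pos, of "- 1 / real p"] unfolding of_nat_1 .
  moreover have "(- 1 / real p) * polar_sum \<theta> powr (- 1 / real p - 1) *
      (real p * (sin \<theta> ^ (p - 1) * cos \<theta> - cos \<theta> ^ (p - 1) * sin \<theta>)) =
      radius \<theta> ^ (p + 1) * (cos \<theta> ^ (p - 1) * sin \<theta> - sin \<theta> ^ (p - 1) * cos \<theta>)"
    unfolding e using p_gt_2 by (simp add: field_simps)
  ultimately show ?thesis
    unfolding radius_def[abs_def] by simp
qed

text \<open>With \<open>radius \<theta> ^ 2\<close> in the role of dt/d\<theta>, this is the
  equation s' = c^(p-1) with the angle as independent variable.\<close>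

lemma DERIV_sin_p:
  assumes "- (pi / 4) < \<theta>" "\<theta> < 3 * pi / 4"
  shows "(sin_p has_real_derivative radius \<theta> ^ 2 * cos_p \<theta> ^ (p - 1)) (at \<theta>)"
proof -
  define r where "r = radius \<theta>"
  define a where "a = sin \<theta> ^ (p - 1)"
  define b where "b = cos \<theta> ^ (p - 1)"
  have rp: "r ^ p * (sin \<theta> * a + cos \<theta> * b) = 1"
    using radius_power_mult_polar_sum[OF assms]
    by (simp add: polar_sum_def r_def a_def b_def power_p[of "sin \<theta>"] power_p[of "cos \<theta>"])
  have "(sin_p has_real_derivative
     r * cos \<theta> + (r ^ (p + 1) * (b * sin \<theta> - a * cos \<theta>)) * sin \<theta>) (at \<theta>)"
    unfolding sin_p_def[abs_def] r_def a_def b_def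
    by (rule derivative_eq_intros DERIV_radius assms refl)+ (simp add: algebra_simps)
  \<comment> \<open>Inserting the factor
    \<open>r ^ p * (sin \<theta> * a + cos \<theta> * b) = 1\<close> lets the terms in
    \<open>a\<close> cancel, and the sum of the squares of sine and cosine splits off.\<close>
  also have "r * cos \<theta> = r ^ (p + 1) * (sin \<theta> * a + cos \<theta> * b) * cos \<theta>"
    using rp by simp
  also have "\<dots> + (r ^ (p + 1) * (b * sin \<theta> - a * cos \<theta>)) * sin \<theta> =
      r ^ (p + 1) * b * ((sin \<theta>)\<^sup>2 + (cos \<theta>)\<^sup>2)"
    by algebra
  also have "\<dots> = r\<^sup>2 * (r * cos \<theta>) ^ (p - 1)"
  proof -
    have "r ^ (p + 1) = r ^ 2 * r ^ (p - 1)"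
      using p_gt_2 by (subst power_add[symmetric]) simp
    then show ?thesis by (simp add: power_mult_distrib b_def)
  qed
  finally show ?thesis by (simp add: r_def cos_p_def)
qed

text \<open>The curve is symmetric under exchange of s and c. This reflection carries results on
  \<open>sin_p\<close> over to \<open>cos_p\<close>, and results at one end of the angular range
  over to the other end.\<close>

lemma radius_reflect: "radius (pi / 2 - \<theta>) = radius \<theta>"
  by (simp add: radius_def polar_sum_def sin_diff cos_diff add.commute)

lemma sin_p_reflect: "sin_p (pi / 2 - \<theta>) = cos_p \<theta>"
  by (simp add: sin_p_def cos_p_def radius_reflect sin_diff)

lemma cos_p_reflect: "cos_p (pi / 2 - \<theta>) = sin_p \<theta>"
  by (simp add: sin_p_def cos_p_def radius_reflect cos_diff)

lemma DERIV_cos_p: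
  assumes "- (pi / 4) < \<theta>" "\<theta> < 3 * pi / 4"
  shows "(cos_p has_real_derivative - (radius \<theta> ^ 2 * sin_p \<theta> ^ (p - 1))) (at \<theta>)"
proof -
  \<comment> \<open>The range is symmetric about \<open>pi / 4\<close>, so the reflected angle stays
    inside it; the inner derivative \<open>- 1\<close> supplies the sign.\<close>
  have "((\<lambda>x. sin_p (pi / 2 - x)) has_real_derivative
      radius (pi / 2 - \<theta>) ^ 2 * cos_p (pi / 2 - \<theta>) ^ (p - 1) * (- 1)) (at \<theta>)"
    by (rule DERIV_chain2[OF DERIV_sin_p]) (use assms in \<open>auto intro!: derivative_eq_intros\<close>)
  then show ?thesis
    by (simp add: sin_p_reflect radius_reflect cos_p_reflect)
qed

lemma isCont_radius:
  assumes "- (pi / 4) < \<theta>" "\<theta> < 3 * pi / 4"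
  shows "isCont radius \<theta>"
  by (rule DERIV_isCont[OF DERIV_radius[OF assms]])

lemma isCont_sin_p:
  assumes "- (pi / 4) < \<theta>" "\<theta> < 3 * pi / 4"
  shows "isCont sin_p \<theta>"
  by (rule DERIV_isCont[OF DERIV_sin_p[OF assms]])

lemma isCont_cos_p:
  assumes "- (pi / 4) < \<theta>" "\<theta> < 3 * pi / 4"
  shows "isCont cos_p \<theta>"
  by (rule DERIV_isCont[OF DERIV_cos_p[OF assms]])

lemma
  shows sin_p_0: "sin_p 0 = 0" and cos_p_0: "cos_p 0 = 1"
    and sin_p_pi_half: "sin_p (pi / 2) = 1" and cos_p_pi_half: "cos_p (pi / 2) = 0"
  using p_gt_2 by (auto simp: sin_p_def cos_p_def radius_def polar_sum_def power_0_left)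

section \<open>Blow-up at the ends of the angular range\<close>

lemma filterlim_radius_at_left: "filterlim radius at_top (at_left (3 * pi / 4))"
proof -
  have lim: "(polar_sum \<longlongrightarrow> polar_sum (3 * pi / 4)) (at_left (3 * pi / 4))"
    unfolding polar_sum_def[abs_def] by (intro tendsto_intros)
  have "polar_sum (3 * pi / 4) = 0"
    using odd_p by (simp add: polar_sum_def sin_135 cos_135)
  \<comment> \<open>Positivity makes \<open>polar_sum\<close> approach 0 from the right, the side on
    which the negative power diverges.\<close>
  moreover have ev: "\<forall>\<^sub>F x in at_left (3 * pi / 4). polar_sum x > 0"
    using eventually_at_left_real[of "0" "3 * pi / 4"]
    by (rule eventually_mono) (use polar_sum_pos in auto)
  ultimately have "filterlim polar_sum (at_right 0) (at_left (3 * pi / 4))"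
    using lim by (auto simp: filterlim_at elim: eventually_mono)
  moreover have "filterlim (\<lambda>x::real. x powr (- 1 / real p)) at_top (at_right 0)"
  proof -
    \<comment> \<open>For \<open>x > 0\<close> the power is the exponential of
      \<open>- ln x / real p\<close>, and \<open>- ln x\<close> tends to infinity as
      \<open>x\<close> falls to 0.\<close>
    have "filterlim (\<lambda>x::real. exp (inverse (real p) * - ln x)) at_top (at_right 0)"
      by (intro filterlim_compose[OF exp_at_top]
          filterlim_tendsto_pos_mult_at_top[OF tendsto_const]
          filterlim_uminus_at_bot[THEN iffD1, OF ln_at_0])
        (use p_gt_2 in auto)
    then show ?thesis
      by (rule filterlim_mono_eventually)
        (auto simp: eventually_at_filter powr_def field_simps)
  qed
  ultimately show ?thesis
    unfolding radius_def[abs_def] by (rule filterlim_compose[rotated])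
qed

lemma filterlim_sin_p_at_left: "filterlim sin_p at_top (at_left (3 * pi / 4))"
proof -
  have "0 < sin (3 * pi / 4)" by (simp add: sin_135)
  moreover have "(sin \<longlongrightarrow> sin (3 * pi / 4)) (at_left (3 * pi / 4))"
    by (intro tendsto_intros)
  ultimately have "filterlim (\<lambda>x. sin x * radius x) at_top (at_left (3 * pi / 4))"
    by (intro filterlim_tendsto_pos_mult_at_top filterlim_radius_at_left)
  then show ?thesis by (simp add: sin_p_def[abs_def] mult.commute)
qed

lemma filterlim_cos_p_at_left: "filterlim (\<lambda>x. - cos_p x) at_top (at_left (3 * pi / 4))"
proof -
  have "0 < - cos (3 * pi / 4)" by (simp add: cos_135)
  moreover have "((\<lambda>x. - cos x) \<longlongrightarrow> - cos (3 * pi / 4)) (at_left (3 * pi / 4))"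
    by (intro tendsto_intros)
  ultimately have "filterlim (\<lambda>x. - cos x * radius x) at_top (at_left (3 * pi / 4))"
    by (intro filterlim_tendsto_pos_mult_at_top filterlim_radius_at_left)
  then show ?thesis by (simp add: cos_p_def[abs_def] mult.commute)
qed

lemma filterlim_reflect_left_end:
  "filterlim (\<lambda>\<phi>::real. pi / 2 - \<phi>) (at_left (3 * pi / 4)) (at_right (- (pi / 4)))"
  unfolding filterlim_at
proof
  have "((\<lambda>\<phi>::real. pi / 2 - \<phi>) \<longlongrightarrow> pi / 2 - (- (pi / 4))) (at_right (- (pi / 4)))"
    by (intro tendsto_intros)
  then show "((\<lambda>\<phi>::real. pi / 2 - \<phi>) \<longlongrightarrow> 3 * pi / 4) (at_right (- (pi / 4)))"
    by simp
  show "\<forall>\<^sub>F x in at_right (- (pi / 4)). pi / 2 - x \<in> {..<3 * pi / 4} \<and> pi / 2 - x \<noteq> 3 * pi / 4"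
    by (auto simp: eventually_at_filter)
qed

lemma filterlim_cos_p_at_right: "filterlim cos_p at_top (at_right (- (pi / 4)))"
  using filterlim_compose[OF filterlim_sin_p_at_left filterlim_reflect_left_end]
  by (simp add: sin_p_reflect)

section \<open>Signs and size of \<open>sin_p\<close> and \<open>cos_p\<close>\<close>

lemma cos_p_neg:
  assumes "pi / 2 < \<theta>" "\<theta> < 3 * pi / 4"
  shows "cos_p \<theta> < 0"
  using radius_pos[of \<theta>] cos_gt_zero_pi[of "pi - \<theta>"] assms pi_gt_zero
  by (simp add: cos_p_def mult_less_0_iff)

lemma cos_p_pos:
  assumes "- (pi / 4) < \<theta>" "\<theta> < pi / 2"
  shows "0 < cos_p \<theta>"
  using radius_pos[of \<theta>] cos_gt_zero_pi[of \<theta>] assms pi_gt_zero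
  by (simp add: cos_p_def zero_less_mult_iff)

lemma sin_p_pos:
  assumes "0 < \<theta>" "\<theta> < 3 * pi / 4"
  shows "0 < sin_p \<theta>"
  using radius_pos[of \<theta>] sin_gt_zero[of \<theta>] assms pi_gt_zero
  by (simp add: sin_p_def zero_less_mult_iff)

text \<open>Evaluates the denominators of both integrands once \<open>1 + x ^ p\<close> or
  \<open>1 - x ^ p\<close> is recognised as a \<open>p\<close>-th power of \<open>sin_p\<close> or
  \<open>cos_p\<close>.\<close>

lemma power_p_powr:
  assumes "0 < x"
  shows "(x ^ p) powr (1 - 1 / real p) = x ^ (p - 1)"
proof -
  have "real p * (1 - 1 / real p) = real (p - 1)"
    using p_gt_2 by (simp add: field_simps of_nat_diff)
  then show ?thesis
    using assms by (simp add: powr_realpow[symmetric] powr_powr)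
qed

text \<open>Bounds the rate \<open>radius \<theta> ^ 2\<close> by the derivative of
  \<open>2 * arctan (- cos_p \<theta>)\<close>, which keeps the time to the right end finite. It
  holds because s^p = 1 + (-c)^p with c \<le> 0 forces both s \<ge> 1 and s \<ge> -c.\<close>

lemma one_plus_cos_p_sq_le:
  assumes "pi / 2 \<le> \<theta>" "\<theta> < 3 * pi / 4"
  shows "1 + (cos_p \<theta>)\<^sup>2 \<le> 2 * sin_p \<theta> ^ (p - 1)"
proof -
  have range: "- (pi / 4) < \<theta>" "0 < \<theta>" using assms pi_gt_zero by linarith+
  have s: "0 < sin_p \<theta>" using sin_p_pos assms range by simp
  have c: "0 \<le> - cos_p \<theta>"
    using cos_p_neg[of \<theta>] cos_p_pi_half assms by (cases "\<theta> = pi / 2") (auto simp del: eq_divide_eq_numeral1)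
  have eq: "sin_p \<theta> ^ p = 1 + (- cos_p \<theta>) ^ p"
    using sin_p_cos_p_power[OF range(1) assms(2)] odd_p by simp
  have p0: "0 < p" using p_gt_2 by simp
  have nn: "0 \<le> (- cos_p \<theta>) ^ p" using c by (rule zero_le_power)
  have "1 ^ p \<le> sin_p \<theta> ^ p" "(- cos_p \<theta>) ^ p \<le> sin_p \<theta> ^ p"
    unfolding eq power_one using nn by linarith+
  then have s1: "1 \<le> sin_p \<theta>" and sc: "- cos_p \<theta> \<le> sin_p \<theta>"
    using power_mono_iff[OF zero_le_one less_imp_le[OF s] p0]
      power_mono_iff[OF c less_imp_le[OF s] p0] by blast+
  \<comment> \<open>Since \<open>p - 1 \<ge> 2\<close> and the base is at least 1, it suffices to
    bound the square, which dominates both 1 and the square of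
    \<open>cos_p \<theta>\<close>.\<close>
  have "sin_p \<theta> ^ 2 \<le> sin_p \<theta> ^ (p - 1)"
    using s1 p_gt_2 by (intro power_increasing) auto
  moreover have "(- cos_p \<theta>) ^ 2 \<le> sin_p \<theta> ^ 2" using sc c by (rule power_mono)
  moreover have "1 \<le> sin_p \<theta> ^ 2" using s1 by simp
  ultimately show ?thesis by simp
qed

section \<open>The constants A and B as integrals of the squared radius\<close>

definition integrand_A :: "real \<Rightarrow> real" where
  "integrand_A x = 1 / (1 - x ^ p) powr (1 - 1 / real p)"

definition integrand_B :: "real \<Rightarrow> real" where
  "integrand_B x = 1 / (1 + x ^ p) powr (1 - 1 / real p)"

text \<open>For \<open>x = - cos_p \<theta>\<close> and \<open>p\<close> odd,
  \<open>1 + x ^ p\<close> equals \<open>sin_p \<theta> ^ p\<close>, so the integrand is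
  \<open>1 / sin_p \<theta> ^ (p - 1)\<close> and cancels that factor of dx. The integrability
  assumed here is supplied later by the time map.\<close>

lemma integral_radius_sq_eq_B:
  assumes "set_integrable lborel (einterval (pi / 2) (3 * pi / 4)) (\<lambda>\<theta>. radius \<theta> ^ 2)"
  shows "(LBINT \<theta>=pi / 2..3 * pi / 4. radius \<theta> ^ 2) = B_const p"
proof -
  have lt: "ereal (pi / 2) < ereal (3 * pi / 4)" using pi_gt_zero by simp
  have eq: "1 + (- cos_p \<theta>) ^ p = sin_p \<theta> ^ p"
    and sp: "0 < sin_p \<theta>" and rg: "- (pi / 4) < \<theta>"
    if "pi / 2 < \<theta>" "\<theta> < 3 * pi / 4" for \<theta>
  proof -
    show "- (pi / 4) < \<theta>" "0 < sin_p \<theta>" using that pi_gt_zero sin_p_pos[of \<theta>] by linarith+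
    then show "1 + (- cos_p \<theta>) ^ p = sin_p \<theta> ^ p"
      using sin_p_cos_p_power[of \<theta>] odd_p that by simp
  qed
  have subst: "integrand_B (- cos_p \<theta>) * (radius \<theta> ^ 2 * sin_p \<theta> ^ (p - 1)) = radius \<theta> ^ 2"
    if "pi / 2 < \<theta>" "\<theta> < 3 * pi / 4" for \<theta>
    unfolding integrand_B_def eq[OF that] power_p_powr[OF sp[OF that]]
    using sp[OF that] by simp
  have cong: "set_integrable lborel (einterval (pi / 2) (3 * pi / 4))
      (\<lambda>\<theta>. integrand_B (- cos_p \<theta>) * (radius \<theta> ^ 2 * sin_p \<theta> ^ (p - 1)))"
    using assms by (subst set_integrable_cong[OF refl refl subst]) auto
  have lim: "((ereal \<circ> (\<lambda>\<theta>. - cos_p \<theta>) \<circ> real_of_ereal) \<longlongrightarrow> 0) (at_right (ereal (pi / 2)))"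
  proof -
    have "isCont (\<lambda>\<theta>. - cos_p \<theta>) (pi / 2)"
      using pi_gt_zero by (intro continuous_intros isCont_cos_p) linarith+
    then have "((\<lambda>\<theta>. - cos_p \<theta>) \<longlongrightarrow> 0) (at_right (pi / 2))"
      using cos_p_pi_half by (simp add: isCont_def filterlim_at_split)
    then show ?thesis
      by (simp add: ereal_tendsto_simps1 ereal_tendsto_simps2 zero_ereal_def)
  qed
  have lim': "((ereal \<circ> (\<lambda>\<theta>. - cos_p \<theta>) \<circ> real_of_ereal) \<longlongrightarrow> \<infinity>) (at_left (ereal (3 * pi / 4)))"
    using filterlim_cos_p_at_left by (simp add: ereal_tendsto_simps1 ereal_tendsto_simps2)
  have deriv: "((\<lambda>x. - cos_p x) has_real_derivative radius \<theta> ^ 2 * sin_p \<theta> ^ (p - 1)) (at \<theta>)"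
    and cont: "isCont integrand_B (- cos_p \<theta>)"
    and cont': "isCont (\<lambda>\<theta>. radius \<theta> ^ 2 * sin_p \<theta> ^ (p - 1)) \<theta>"
    if "ereal (pi / 2) < ereal \<theta>" "ereal \<theta> < ereal (3 * pi / 4)" for \<theta>
  proof -
    have b: "pi / 2 < \<theta>" "\<theta> < 3 * pi / 4" using that by auto
    note r = rg[OF b] b(2)
    show "((\<lambda>x. - cos_p x) has_real_derivative radius \<theta> ^ 2 * sin_p \<theta> ^ (p - 1)) (at \<theta>)"
      using DERIV_minus[OF DERIV_cos_p[OF r]] by simp
    have "1 + (- cos_p \<theta>) ^ p \<noteq> 0" using eq[OF b] sp[OF b] by simp
    then show "isCont integrand_B (- cos_p \<theta>)"
      unfolding integrand_B_def[abs_def] by (intro continuous_intros) auto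
    show "isCont (\<lambda>\<theta>. radius \<theta> ^ 2 * sin_p \<theta> ^ (p - 1)) \<theta>"
      by (intro continuous_intros isCont_radius isCont_sin_p r)
  qed
  have nonneg: "0 \<le> integrand_B x" for x by (simp add: integrand_B_def)
  \<comment> \<open>The even exponent gives this at every angle without regard to the sign of
    \<open>sin_p\<close>, hence also at the ends of the range of integration.\<close>
  have nonneg': "0 \<le> radius \<theta> ^ 2 * sin_p \<theta> ^ (p - 1)" for \<theta>
    using even_p_minus_1 by (simp add: zero_le_even_power)
  note * = interval_integral_substitution_nonneg[where f = integrand_B and g = "\<lambda>x. - cos_p x"
      and g' = "\<lambda>\<theta>. radius \<theta> ^ 2 * sin_p \<theta> ^ (p - 1)", OF lt deriv cont cont' nonneg nonneg' lim lim' cong]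
  have "(LBINT \<theta>=pi / 2..3 * pi / 4. radius \<theta> ^ 2) =
    (LBINT \<theta>=pi / 2..3 * pi / 4. integrand_B (- cos_p \<theta>) * (radius \<theta> ^ 2 * sin_p \<theta> ^ (p - 1)))"
    by (rule interval_integral_cong) (use lt subst in \<open>auto simp: einterval_iff min_def max_def\<close>)
  also have "\<dots> = (LBINT x=0..\<infinity>. integrand_B x)" using * by simp
  also have "\<dots> = integral {0<..} integrand_B"
    using set_borel_integral_eq_integral(2)[of "{0<..}" integrand_B] *
    unfolding zero_ereal_def by (simp add: interval_integral_to_infinity_eq)
  \<comment> \<open>The domains differ by the single point 0, a negligible set.\<close>
  also have "\<dots> = integral {0..} integrand_B"
    by (rule integral_subset_negligible) (auto intro: negligible_subset[of "{0}"])
  finally show ?thesis by (simp add: B_const_def integrand_B_def[abs_def])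
qed

text \<open>For \<open>x = sin_p \<theta>\<close> the relation
  \<open>1 - x ^ p = cos_p \<theta> ^ p\<close> makes the integrand cancel the factor
  \<open>cos_p \<theta> ^ (p - 1)\<close> of dx.\<close>

lemma integral_radius_sq_eq_A:
  assumes "set_integrable lborel (einterval 0 (pi / 2)) (\<lambda>\<theta>. radius \<theta> ^ 2)"
  shows "(LBINT \<theta>=0..pi / 2. radius \<theta> ^ 2) = A_const p"
proof -
  have lt: "0 < ereal (pi / 2)" using pi_gt_zero by simp
  have rg: "- (pi / 4) < \<theta>" "\<theta> < 3 * pi / 4" and cp: "0 < cos_p \<theta>"
    and eq: "1 - sin_p \<theta> ^ p = cos_p \<theta> ^ p"
    if "0 < \<theta>" "\<theta> < pi / 2" for \<theta>
  proof -
    show "- (pi / 4) < \<theta>" "\<theta> < 3 * pi / 4" "0 < cos_p \<theta>"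
      using that pi_gt_zero cos_p_pos[of \<theta>] by linarith+
    then show "1 - sin_p \<theta> ^ p = cos_p \<theta> ^ p"
      using sin_p_cos_p_power[of \<theta>] by simp
  qed
  have subst: "integrand_A (sin_p \<theta>) * (radius \<theta> ^ 2 * cos_p \<theta> ^ (p - 1)) = radius \<theta> ^ 2"
    if "0 < \<theta>" "\<theta> < pi / 2" for \<theta>
    unfolding integrand_A_def eq[OF that] power_p_powr[OF cp[OF that]]
    using cp[OF that] by simp
  have cong: "set_integrable lborel (einterval 0 (pi / 2))
      (\<lambda>\<theta>. integrand_A (sin_p \<theta>) * (radius \<theta> ^ 2 * cos_p \<theta> ^ (p - 1)))"
    using assms by (subst set_integrable_cong[OF refl refl subst]) (auto simp: einterval_iff)
  have lim: "((ereal \<circ> sin_p \<circ> real_of_ereal) \<longlongrightarrow> 0) (at_right 0)"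
  proof -
    have "isCont sin_p 0" using pi_gt_zero by (intro isCont_sin_p) linarith+
    then have "(sin_p \<longlongrightarrow> 0) (at_right 0)"
      using sin_p_0 by (simp add: isCont_def filterlim_at_split)
    then show ?thesis
      by (simp add: ereal_tendsto_simps1 ereal_tendsto_simps2 zero_ereal_def)
  qed
  have lim': "((ereal \<circ> sin_p \<circ> real_of_ereal) \<longlongrightarrow> 1) (at_left (ereal (pi / 2)))"
  proof -
    have "isCont sin_p (pi / 2)" using pi_gt_zero by (intro isCont_sin_p) linarith+
    then have "(sin_p \<longlongrightarrow> 1) (at_left (pi / 2))"
      using sin_p_pi_half by (simp add: isCont_def filterlim_at_split)
    then show ?thesis
      by (simp add: ereal_tendsto_simps1 ereal_tendsto_simps2 one_ereal_def)
  qed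
  have deriv: "((sin_p) has_real_derivative radius \<theta> ^ 2 * cos_p \<theta> ^ (p - 1)) (at \<theta>)"
    and cont: "isCont integrand_A (sin_p \<theta>)"
    and cont': "isCont (\<lambda>\<theta>. radius \<theta> ^ 2 * cos_p \<theta> ^ (p - 1)) \<theta>"
    if "0 < ereal \<theta>" "ereal \<theta> < ereal (pi / 2)" for \<theta>
  proof -
    have b: "0 < \<theta>" "\<theta> < pi / 2" using that by auto
    note r = rg[OF b]
    show "((sin_p) has_real_derivative radius \<theta> ^ 2 * cos_p \<theta> ^ (p - 1)) (at \<theta>)"
      by (rule DERIV_sin_p[OF r])
    have "1 - sin_p \<theta> ^ p \<noteq> 0" using eq[OF b] cp[OF b] by simp
    then show "isCont integrand_A (sin_p \<theta>)"
      unfolding integrand_A_def[abs_def] by (intro continuous_intros) auto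
    show "isCont (\<lambda>\<theta>. radius \<theta> ^ 2 * cos_p \<theta> ^ (p - 1)) \<theta>"
      by (intro continuous_intros isCont_radius isCont_cos_p r)
  qed
  have nonneg: "0 \<le> integrand_A x" for x by (simp add: integrand_A_def)
  have nonneg': "0 \<le> radius \<theta> ^ 2 * cos_p \<theta> ^ (p - 1)" for \<theta>
    using even_p_minus_1 by (simp add: zero_le_even_power)
  note * = interval_integral_substitution_nonneg[where f = integrand_A and g = "sin_p"
      and g' = "\<lambda>\<theta>. radius \<theta> ^ 2 * cos_p \<theta> ^ (p - 1)", OF lt deriv cont cont' nonneg nonneg' lim lim' cong]
  have "(LBINT \<theta>=0..pi / 2. radius \<theta> ^ 2) =
    (LBINT \<theta>=0..pi / 2. integrand_A (sin_p \<theta>) * (radius \<theta> ^ 2 * cos_p \<theta> ^ (p - 1)))"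
    by (rule interval_integral_cong) (use lt subst in \<open>auto simp: einterval_iff min_def max_def\<close>)
  also have "\<dots> = (LBINT x=0..1. integrand_A x)" using * by simp
  also have "\<dots> = integral {0<..<1} integrand_A"
    using set_borel_integral_eq_integral(2)[of "{0<..<1}" integrand_A] *
    unfolding zero_ereal_def one_ereal_def by (simp add: interval_lebesgue_integral_le_eq)
  \<comment> \<open>The two endpoints are negligible, among them the singularity
    \<open>x = 1\<close>, where the integrand has the default value 0.\<close>
  also have "\<dots> = integral {0..1} integrand_A"
    by (rule integral_subset_negligible) (auto intro: negligible_subset[of "{0, 1}"])
  finally show ?thesis by (simp add: A_const_def integrand_A_def[abs_def])
qed

end

section \<open>Time as a function of the angle\<close>

text \<open>The additive constant of \<open>T\<close> is left free, so that the reflected map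
  \<open>\<lambda>\<theta>. - T (pi / 2 - \<theta>)\<close> is again an instance and the left end
  can be reduced to the right end.\<close>

locale time_map = odd_exponent +
  fixes T :: "real \<Rightarrow> real"
  assumes DERIV_T: "\<And>\<theta>. - (pi / 4) < \<theta> \<Longrightarrow> \<theta> < 3 * pi / 4 \<Longrightarrow>
    (T has_real_derivative radius \<theta> ^ 2) (at \<theta>)"
begin

lemma isCont_T:
  assumes "- (pi / 4) < \<theta>" "\<theta> < 3 * pi / 4"
  shows "isCont T \<theta>"
  by (rule DERIV_isCont[OF DERIV_T[OF assms]])

lemma T_less:
  assumes "- (pi / 4) < \<theta>" "\<theta> < \<phi>" "\<phi> < 3 * pi / 4"
  shows "T \<theta> < T \<phi>"
proof (rule DERIV_pos_imp_increasing[OF assms(2)])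
  fix x assume x: "\<theta> \<le> x" "x \<le> \<phi>"
  then have "- (pi / 4) < x" "x < 3 * pi / 4" using assms by linarith+
  then show "\<exists>y. (T has_real_derivative y) (at x) \<and> 0 < y"
    using DERIV_T[of x] radius_pos[of x] by auto
qed

text \<open>From \<open>pi / 2\<close> on, \<open>2 * arctan (- cos_p x)\<close> grows at least as
  fast as \<open>T x\<close>. It starts at 0, because \<open>cos_p\<close> vanishes at
  \<open>pi / 2\<close>, and stays below \<open>pi\<close>.\<close>

lemma T_bounded:
  assumes "pi / 2 < \<theta>" "\<theta> < 3 * pi / 4"
  shows "T \<theta> \<le> T (pi / 2) + pi"
proof -
  have "2 * arctan (- cos_p (pi / 2)) - T (pi / 2) \<le> 2 * arctan (- cos_p \<theta>) - T \<theta>"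
  proof (rule DERIV_nonneg_imp_nondecreasing[where f = "\<lambda>x. 2 * arctan (- cos_p x) - T x"])
    show "pi / 2 \<le> \<theta>" using assms by simp
    fix x assume "pi / 2 \<le> x" "x \<le> \<theta>"
    then have x: "- (pi / 4) < x" "pi / 2 \<le> x" "x < 3 * pi / 4"
      using assms pi_gt_zero by linarith+
    define D where "D = 2 * (inverse (1 + (cos_p x)\<^sup>2) * (radius x ^ 2 * sin_p x ^ (p - 1)))
        - radius x ^ 2"
    have "((\<lambda>x. 2 * arctan (- cos_p x) - T x) has_real_derivative D) (at x)"
      unfolding D_def using x
      by (auto intro!: derivative_eq_intros DERIV_cos_p DERIV_T)
    moreover have "0 \<le> D"
    proof -
      have "0 < 1 + (cos_p x)\<^sup>2" by (simp add: add_pos_nonneg)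
      then have "D = radius x ^ 2 * ((2 * sin_p x ^ (p - 1) - (1 + (cos_p x)\<^sup>2)) / (1 + (cos_p x)\<^sup>2))"
        by (simp add: D_def field_simps)
      also have "\<dots> \<ge> 0"
        using one_plus_cos_p_sq_le[OF x(2,3)] by (intro mult_nonneg_nonneg divide_nonneg_nonneg) auto
      finally show ?thesis .
    qed
    ultimately show "\<exists>y. ((\<lambda>x. 2 * arctan (- cos_p x) - T x) has_real_derivative y) (at x) \<and> 0 \<le> y"
      by blast
  qed
  then show ?thesis
    using arctan_ubound[of "- cos_p \<theta>"] cos_p_pi_half by simp
qed

text \<open>Being increasing and bounded, \<open>T\<close> has a finite left limit; the fundamental
  theorem turns its increment into the integral of the squared radius, which is B.\<close>

lemma T_tendsto_right_end: "(T \<longlongrightarrow> T (pi / 2) + B_const p) (at_left (3 * pi / 4))"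
proof -
  have lt: "pi / 2 < 3 * pi / 4" using pi_gt_zero by simp
  \<comment> \<open>The left limit of an increasing function bounded above is its supremum.\<close>
  define L where "L = Sup (T ` {pi / 2<..<3 * pi / 4})"
  have ne: "T ` {pi / 2<..<3 * pi / 4} \<noteq> {}" using lt by simp
  have bdd: "bdd_above (T ` {pi / 2<..<3 * pi / 4})"
    by (rule bdd_aboveI[of _ "T (pi / 2) + pi"]) (use T_bounded in auto)
  have L: "(T \<longlongrightarrow> L) (at_left (3 * pi / 4))"
  proof (rule increasing_tendsto)
    show "\<forall>\<^sub>F \<theta> in at_left (3 * pi / 4). T \<theta> \<le> L"
      using eventually_at_left_real[OF lt]
      by (rule eventually_mono) (auto simp: L_def intro!: cSup_upper bdd)
    fix x assume "x < L"
    then obtain \<phi> where \<phi>: "pi / 2 < \<phi>" "\<phi> < 3 * pi / 4" "x < T \<phi>"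
      unfolding L_def using less_cSup_iff[OF ne bdd] by auto
    show "\<forall>\<^sub>F \<theta> in at_left (3 * pi / 4). x < T \<theta>"
      using eventually_at_left_real[OF \<phi>(2)]
    proof (rule eventually_mono)
      fix \<theta> assume "\<theta> \<in> {\<phi><..<3 * pi / 4}"
      then have "T \<phi> < T \<theta>" using \<phi> pi_gt_zero by (intro T_less) auto
      then show "x < T \<theta>" using \<phi> by simp
    qed
  qed
  have "(T \<longlongrightarrow> T (pi / 2)) (at_right (pi / 2))"
    using isCont_T[of "pi / 2"] pi_gt_zero by (simp add: isCont_def filterlim_at_split)
  then have lims: "((T \<circ> real_of_ereal) \<longlongrightarrow> T (pi / 2)) (at_right (ereal (pi / 2)))"
      "((T \<circ> real_of_ereal) \<longlongrightarrow> L) (at_left (ereal (3 * pi / 4)))"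
    using L by (simp_all add: ereal_tendsto_simps1)
  have rg: "- (pi / 4) < \<theta>" "\<theta> < 3 * pi / 4"
    if "ereal (pi / 2) < ereal \<theta>" "ereal \<theta> < ereal (3 * pi / 4)" for \<theta>
    using that pi_gt_zero by auto
  \<comment> \<open>For a nonnegative integrand, finite limits of the antiderivative at both ends
    already give integrability, as \<open>integral_radius_sq_eq_B\<close> demands.\<close>
  have "set_integrable lborel (einterval (pi / 2) (3 * pi / 4)) (\<lambda>\<theta>. radius \<theta> ^ 2)"
    "(LBINT \<theta>=pi / 2..3 * pi / 4. radius \<theta> ^ 2) = L - T (pi / 2)"
    by (rule interval_integral_FTC_nonneg[OF _ _ _ _ lims],
        use lt rg in \<open>auto intro!: DERIV_T continuous_intros isCont_radius\<close>)+
  then show ?thesis using integral_radius_sq_eq_B L by simp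
qed

text \<open>Both angles are interior to the range, so the limits in the fundamental theorem are
  values of \<open>T\<close> by continuity.\<close>

lemma T_pi_half_eq: "T (pi / 2) = T 0 + A_const p"
proof -
  have "(T \<longlongrightarrow> T (pi / 2)) (at_left (pi / 2))" "(T \<longlongrightarrow> T 0) (at_right 0)"
    using isCont_T[of "pi / 2"] isCont_T[of 0] pi_gt_zero
    by (simp_all add: isCont_def filterlim_at_split)
  then have lims: "((T \<circ> real_of_ereal) \<longlongrightarrow> T 0) (at_right 0)"
    "((T \<circ> real_of_ereal) \<longlongrightarrow> T (pi / 2)) (at_left (ereal (pi / 2)))"
    by (simp_all add: ereal_tendsto_simps1 zero_ereal_def)
  have rg: "- (pi / 4) < \<theta>" "\<theta> < 3 * pi / 4"
    if "0 < ereal \<theta>" "ereal \<theta> < ereal (pi / 2)" for \<theta>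
    using that pi_gt_zero by auto
  have "set_integrable lborel (einterval 0 (pi / 2)) (\<lambda>\<theta>. radius \<theta> ^ 2)"
    "(LBINT \<theta>=0..pi / 2. radius \<theta> ^ 2) = T (pi / 2) - T 0"
    by (rule interval_integral_FTC_nonneg[OF _ _ _ _ lims],
        use rg in \<open>auto intro!: DERIV_T continuous_intros isCont_radius\<close>)+
  then show ?thesis using integral_radius_sq_eq_A by simp
qed

lemma time_map_reflect: "time_map p (\<lambda>\<theta>. - T (pi / 2 - \<theta>))"
proof
  fix \<theta> assume \<theta>: "- (pi / 4) < \<theta>" "\<theta> < 3 * pi / 4"
  have "((\<lambda>\<theta>. T (pi / 2 - \<theta>)) has_real_derivative radius (pi / 2 - \<theta>) ^ 2 * (- 1)) (at \<theta>)"
    by (rule DERIV_chain2[OF DERIV_T]) (use \<theta> in \<open>auto intro!: derivative_eq_intros\<close>)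
  then show "((\<lambda>\<theta>. - T (pi / 2 - \<theta>)) has_real_derivative (radius \<theta>)\<^sup>2) (at \<theta>)"
    using DERIV_minus by (fastforce simp: radius_reflect)
qed

text \<open>The reflected time map takes the value \<open>- T 0\<close> at \<open>pi / 2\<close>, so
  its limit at the right end is \<open>- T 0 + B_const p\<close>; reflecting back changes the sign
  and the end.\<close>

lemma T_tendsto_left_end: "(T \<longlongrightarrow> T 0 - B_const p) (at_right (- (pi / 4)))"
proof -
  have "((\<lambda>\<theta>. - T (pi / 2 - \<theta>)) \<longlongrightarrow> - T 0 + B_const p) (at_left (3 * pi / 4))"
    using time_map.T_tendsto_right_end[OF time_map_reflect] by simp
  then have lim: "((\<lambda>\<theta>. T (pi / 2 - \<theta>)) \<longlongrightarrow> T 0 - B_const p) (at_left (3 * pi / 4))"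
    using tendsto_minus by fastforce
  have "filterlim (\<lambda>\<phi>. pi / 2 - \<phi>) (at_left (3 * pi / 4)) (at_right (- (pi / 4)))"
    using filterlim_reflect_left_end .
  from filterlim_compose[OF lim this] show ?thesis by simp
qed

text \<open>The limits at the ends bound \<open>T\<close> only weakly; strictness comes from a
  further angle chosen between \<open>\<theta>\<close> and the end.\<close>

lemma T_range:
  assumes "- (pi / 4) < \<theta>" "\<theta> < 3 * pi / 4"
  shows "T 0 - B_const p < T \<theta>" "T \<theta> < T 0 + A_const p + B_const p"
proof -
  obtain \<phi> where \<phi>: "\<theta> < \<phi>" "\<phi> < 3 * pi / 4" using assms dense by blast
  have "T \<phi> \<le> T (pi / 2) + B_const p"
  proof (rule tendsto_lowerbound[OF T_tendsto_right_end])
    show "\<forall>\<^sub>F x in at_left (3 * pi / 4). T \<phi> \<le> T x"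
      using eventually_at_left_real[OF \<phi>(2)]
      by (rule eventually_mono) (use T_less[of \<phi>] \<phi> assms in \<open>auto intro!: less_imp_le\<close>)
  qed simp
  then show "T \<theta> < T 0 + A_const p + B_const p"
    using T_less[OF assms(1) \<phi>] T_pi_half_eq by simp
  obtain \<psi> where \<psi>: "- (pi / 4) < \<psi>" "\<psi> < \<theta>" using assms dense by blast
  have "T 0 - B_const p \<le> T \<psi>"
  proof (rule tendsto_upperbound[OF T_tendsto_left_end])
    show "\<forall>\<^sub>F x in at_right (- (pi / 4)). T x \<le> T \<psi>"
      using eventually_at_right_real[OF \<psi>(1)]
      by (rule eventually_mono) (use T_less[of _ \<psi>] \<psi> assms in \<open>auto intro!: less_imp_le\<close>)
  qed simp
  then show "T 0 - B_const p < T \<theta>"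
    using T_less[OF \<psi> assms(2)] by simp
qed

text \<open>The limits at the two ends yield angles with times on either side of \<open>t\<close>,
  and the intermediate value theorem applies between them.\<close>

lemma T_surj:
  assumes "T 0 - B_const p < t" "t < T 0 + A_const p + B_const p"
  obtains \<theta> where "- (pi / 4) < \<theta>" "\<theta> < 3 * pi / 4" "T \<theta> = t"
proof -
  have "\<forall>\<^sub>F x in at_left (3 * pi / 4). t < T x"
    using order_tendstoD(1)[OF T_tendsto_right_end, of t] assms T_pi_half_eq by simp
  \<comment> \<open>The midpoint \<open>pi / 4\<close> of the range separates the two angles and
    ensures \<open>a < b\<close>.\<close>
  moreover have "\<forall>\<^sub>F x in at_left (3 * pi / 4). x \<in> {pi / 4<..<3 * pi / 4}"
    by (rule eventually_at_left_real) simp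
  ultimately have "\<forall>\<^sub>F x in at_left (3 * pi / 4). t < T x \<and> x \<in> {pi / 4<..<3 * pi / 4}"
    by (rule eventually_conj)
  then obtain b where b: "t < T b" "pi / 4 < b" "b < 3 * pi / 4"
    using eventually_happens'[of "at_left (3 * pi / 4)"] by fastforce
  have "\<forall>\<^sub>F x in at_right (- (pi / 4)). T x < t"
    using order_tendstoD(2)[OF T_tendsto_left_end, of t] assms by simp
  moreover have "\<forall>\<^sub>F x in at_right (- (pi / 4)). x \<in> {- (pi / 4)<..<pi / 4}"
    by (rule eventually_at_right_real) simp
  ultimately have "\<forall>\<^sub>F x in at_right (- (pi / 4)). T x < t \<and> x \<in> {- (pi / 4)<..<pi / 4}"
    by (rule eventually_conj)
  then obtain a where a: "T a < t" "- (pi / 4) < a" "a < pi / 4"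
    using eventually_happens'[of "at_right (- (pi / 4))"] by fastforce
  have "\<exists>x\<ge>a. x \<le> b \<and> T x = t"
    by (rule IVT) (use a b in \<open>auto intro!: isCont_T\<close>)
  then obtain x where "a \<le> x" "x \<le> b" "T x = t" by blast
  then show ?thesis using that[of x] a b by linarith
qed

section \<open>Inversion of the time map and the solution in time\<close>

text \<open>The inverse of \<open>T\<close>; it is only meaningful between \<open>T 0 - B_const p\<close> and
  \<open>T 0 + A_const p + B_const p\<close>.\<close>

definition angle :: "real \<Rightarrow> real" where
  "angle t = (THE \<theta>. - (pi / 4) < \<theta> \<and> \<theta> < 3 * pi / 4 \<and> T \<theta> = t)"

lemma angle_T:
  assumes "- (pi / 4) < \<theta>" "\<theta> < 3 * pi / 4"
  shows "angle (T \<theta>) = \<theta>"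
  unfolding angle_def
proof (rule the_equality)
  fix x assume "- (pi / 4) < x \<and> x < 3 * pi / 4 \<and> T x = T \<theta>"
  then show "x = \<theta>"
    using T_less[of x \<theta>] T_less[of \<theta> x] assms by (metis less_irrefl linorder_neqE_linordered_idom)
qed (use assms in auto)

lemma DERIV_angle:
  assumes "- (pi / 4) < \<theta>" "\<theta> < 3 * pi / 4"
  shows "(angle has_real_derivative inverse (radius \<theta> ^ 2)) (at (T \<theta>))"
proof (rule DERIV_inverse_function)
  show "(T has_real_derivative (radius \<theta>)\<^sup>2) (at (angle (T \<theta>)))"
    using angle_T[OF assms] DERIV_T[OF assms] by simp
  show "(radius \<theta>)\<^sup>2 \<noteq> 0" using radius_pos[OF assms] by simp
  show "T 0 - B_const p < T \<theta>" "T \<theta> < T 0 + A_const p + B_const p"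
    by (rule T_range[OF assms])+
  show "T (angle t) = t" if "T 0 - B_const p < t" "t < T 0 + A_const p + B_const p" for t
    using T_surj[OF that] angle_T by metis
  \<comment> \<open>Half the distance to the nearer end, so that the closed neighbourhood of radius
    \<open>d\<close> about \<open>\<theta>\<close> stays inside the open range.\<close>
  define d where "d = min (\<theta> + pi / 4) (3 * pi / 4 - \<theta>) / 2"
  have d: "- (pi / 4) < z" "z < 3 * pi / 4" if "\<bar>z - \<theta>\<bar> \<le> d" for z
  proof -
    have "d \<le> (\<theta> + pi / 4) / 2" "d \<le> (3 * pi / 4 - \<theta>) / 2"
      unfolding d_def by (simp_all del: min_less_iff_conj)
    moreover have "\<theta> - d \<le> z" "z \<le> \<theta> + d" using that by (simp_all add: abs_le_iff)
    ultimately show "- (pi / 4) < z" "z < 3 * pi / 4"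
      using assms by (simp_all add: field_simps)
  qed
  have "0 < d" using assms unfolding d_def by auto
  then show "isCont angle (T \<theta>)"
    by (rule isCont_inverse_function) (use d in \<open>auto intro: angle_T isCont_T\<close>)
qed

text \<open>By the chain rule the derivative of \<open>angle\<close> cancels the factor
  \<open>radius \<theta> ^ 2\<close> of the equations in the angle. The normalisation
  \<open>T 0 = 0\<close> makes time 0 correspond to angle 0, where the initial values hold.\<close>

lemma solution_pair_angle:
  assumes "T 0 = 0"
  shows "solution_pair p {- B_const p<..<A_const p + B_const p} (sin_p \<circ> angle) (cos_p \<circ> angle)"
proof -
  let ?I = "{- B_const p<..<A_const p + B_const p}"
  have zero: "- (pi / 4) < (0::real)" "0 < 3 * pi / 4" by auto
  have angle_0: "angle 0 = 0" using angle_T[OF zero] assms by simp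
  have "0 \<in> ?I" using T_range[OF zero] assms by simp
  moreover have "((sin_p \<circ> angle) has_real_derivative (cos_p \<circ> angle) t ^ (p - 1)) (at t within ?I)
    \<and> ((cos_p \<circ> angle) has_real_derivative - ((sin_p \<circ> angle) t ^ (p - 1))) (at t within ?I)"
    if "t \<in> ?I" for t
  proof -
    obtain \<theta> where \<theta>: "- (pi / 4) < \<theta>" "\<theta> < 3 * pi / 4" "T \<theta> = t"
      using T_surj[of t] \<open>t \<in> ?I\<close> assms by auto
    have a: "angle t = \<theta>" using angle_T[OF \<theta>(1,2)] \<theta>(3) by simp
    have r: "radius \<theta> \<noteq> 0" using radius_pos[OF \<theta>(1,2)] by simp
    have da: "(angle has_real_derivative inverse (radius \<theta> ^ 2)) (at t)"
      using DERIV_angle[OF \<theta>(1,2)] \<theta>(3) by simp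
    have "((sin_p \<circ> angle) has_real_derivative
        radius \<theta> ^ 2 * cos_p \<theta> ^ (p - 1) * inverse (radius \<theta> ^ 2)) (at t)"
      "((cos_p \<circ> angle) has_real_derivative
        - (radius \<theta> ^ 2 * sin_p \<theta> ^ (p - 1)) * inverse (radius \<theta> ^ 2)) (at t)"
      by (rule DERIV_chain[OF _ da], unfold a, rule DERIV_sin_p DERIV_cos_p, fact \<theta>, fact \<theta>)+
    moreover have "radius \<theta> ^ 2 * x * inverse (radius \<theta> ^ 2) = x"
      "- (radius \<theta> ^ 2 * x) * inverse (radius \<theta> ^ 2) = - x" for x
      using r by simp_all
    ultimately show ?thesis
      unfolding comp_apply a by (simp only: has_field_derivative_at_within)
  qed
  ultimately show ?thesis
    unfolding solution_pair_def using angle_0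
    by (auto simp: is_interval_oo sin_p_0 cos_p_0)
qed

section \<open>Maximality of the interval\<close>

text \<open>A strictly larger interval contains an end point of the given one. There the extended
  pair would be continuous, whereas \<open>sin_p\<close> is unbounded at the right end and
  \<open>cos_p\<close> at the left end.\<close>

lemma not_extends_to_angle:
  assumes T0: "T 0 = 0" and J: "is_interval J" "{- B_const p<..<A_const p + B_const p} \<subset> J"
  shows "\<not> extends_to p {- B_const p<..<A_const p + B_const p} (sin_p \<circ> angle) (cos_p \<circ> angle) J"
proof
  let ?l = "- B_const p" and ?r = "A_const p + B_const p"
  assume "extends_to p {?l<..<?r} (sin_p \<circ> angle) (cos_p \<circ> angle) J"
  then obtain s c where sol: "solution_pair p J s c"
    and ext: "\<And>t. t \<in> {?l<..<?r} \<Longrightarrow> s t = sin_p (angle t) \<and> c t = cos_p (angle t)"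
    unfolding extends_to_def by auto
  have range: "T \<theta> \<in> {?l<..<?r}" if "- (pi / 4) < \<theta>" "\<theta> < 3 * pi / 4" for \<theta>
    using T_range[OF that] T0 by simp
  \<comment> \<open>Filters of the form \<open>at t within J\<close> are punctured, so the approach
    along \<open>T\<close> must avoid the end points as well as stay in \<open>J\<close>.\<close>
  have TJ: "T \<theta> \<in> J" "T \<theta> \<noteq> ?r" "T \<theta> \<noteq> ?l"
    if "- (pi / 4) < \<theta>" "\<theta> < 3 * pi / 4" for \<theta>
    using range[OF that] J(2) by (blast, simp_all)
  have sT: "s (T \<theta>) = sin_p \<theta>" "c (T \<theta>) = cos_p \<theta>"
    if "- (pi / 4) < \<theta>" "\<theta> < 3 * pi / 4" for \<theta>
    using ext[OF range[OF that]] angle_T[OF that] by auto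
  have lims: "(s \<longlongrightarrow> s t) (at t within J)" "(c \<longlongrightarrow> c t) (at t within J)" if "t \<in> J" for t
    using sol that unfolding solution_pair_def
    by (meson DERIV_continuous continuous_within)+
  obtain t where t: "t \<in> J" "t \<notin> {?l<..<?r}" using J(2) by blast
  have "0 \<in> {?l<..<?r}" using range[of 0] T0 by simp
  then have "0 \<in> J" using J(2) by blast
  \<comment> \<open>\<open>J\<close> contains 0 and the outside point \<open>t\<close>, hence also
    the end point that separates them or equals \<open>t\<close>.\<close>
  have "?l \<in> J \<or> ?r \<in> J"
  proof (cases "t \<le> ?l")
    case True
    then show ?thesis
      using mem_is_interval_1_I[OF J(1) t(1) \<open>0 \<in> J\<close>, of ?l] \<open>0 \<in> {?l<..<?r}\<close> by auto
  next
    case False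
    then show ?thesis
      using mem_is_interval_1_I[OF J(1) \<open>0 \<in> J\<close> t(1), of ?r] \<open>0 \<in> {?l<..<?r}\<close> t(2) by auto
  qed
  then show False
  proof
    assume r: "?r \<in> J"
    have ev: "\<forall>\<^sub>F \<theta> in at_left (3 * pi / 4). \<theta> \<in> {- (pi / 4)<..<3 * pi / 4}"
      by (rule eventually_at_left_real) simp
    have "filterlim T (at ?r within J) (at_left (3 * pi / 4))"
      unfolding filterlim_at
    proof
      show "\<forall>\<^sub>F \<theta> in at_left (3 * pi / 4). T \<theta> \<in> J \<and> T \<theta> \<noteq> ?r"
        using ev by (rule eventually_mono) (use TJ in auto)
      show "(T \<longlongrightarrow> ?r) (at_left (3 * pi / 4))"
        using T_tendsto_right_end T_pi_half_eq T0 by simp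
    qed
    \<comment> \<open>Continuity of \<open>s\<close> at the end point, pulled back along
      \<open>T\<close>, would give \<open>sin_p\<close> a finite limit.\<close>
    then have "((\<lambda>\<theta>. s (T \<theta>)) \<longlongrightarrow> s ?r) (at_left (3 * pi / 4))"
      by (rule filterlim_compose[OF lims(1)[OF r]])
    moreover have "\<forall>\<^sub>F \<theta> in at_left (3 * pi / 4). s (T \<theta>) = sin_p \<theta>"
      using ev by (rule eventually_mono) (use sT in auto)
    ultimately have "(sin_p \<longlongrightarrow> s ?r) (at_left (3 * pi / 4))"
      by (rule Lim_transform_eventually)
    then show False
      using not_tendsto_and_filterlim_at_infinity[OF _ _ filterlim_at_top_imp_at_infinity[OF filterlim_sin_p_at_left]]
      by simp
  next
    assume l: "?l \<in> J"
    have ev: "\<forall>\<^sub>F \<theta> in at_right (- (pi / 4)). \<theta> \<in> {- (pi / 4)<..<3 * pi / 4}"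
      by (rule eventually_at_right_real) simp
    have "filterlim T (at ?l within J) (at_right (- (pi / 4)))"
      unfolding filterlim_at
    proof
      show "\<forall>\<^sub>F \<theta> in at_right (- (pi / 4)). T \<theta> \<in> J \<and> T \<theta> \<noteq> ?l"
        using ev by (rule eventually_mono) (use TJ in auto)
      show "(T \<longlongrightarrow> ?l) (at_right (- (pi / 4)))"
        using T_tendsto_left_end T0 by simp
    qed
    then have "((\<lambda>\<theta>. c (T \<theta>)) \<longlongrightarrow> c ?l) (at_right (- (pi / 4)))"
      by (rule filterlim_compose[OF lims(2)[OF l]])
    moreover have "\<forall>\<^sub>F \<theta> in at_right (- (pi / 4)). c (T \<theta>) = cos_p \<theta>"
      using ev by (rule eventually_mono) (use sT in auto)
    ultimately have "(cos_p \<longlongrightarrow> c ?l) (at_right (- (pi / 4)))"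
      by (rule Lim_transform_eventually)
    then show False
      using not_tendsto_and_filterlim_at_infinity[OF _ _ filterlim_at_top_imp_at_infinity[OF filterlim_cos_p_at_right]]
      by simp
  qed
qed

end

section \<open>Existence of the time map\<close>

context odd_exponent
begin

text \<open>The squared radius is continuous on the open angular range and so has an antiderivative
  there; subtracting its value at 0 fixes the origin of time.\<close>

lemma time_map_exists:
  obtains T where "time_map p T" "T 0 = 0"
proof -
  have lt: "ereal (- (pi / 4)) < ereal (3 * pi / 4)"
    using pi_gt_zero unfolding less_ereal.simps by linarith
  have "\<exists>F. \<forall>x. ereal (- (pi / 4)) < ereal x \<longrightarrow> ereal x < ereal (3 * pi / 4) \<longrightarrow>
      (F has_real_derivative radius x ^ 2) (at x)"
    unfolding has_real_derivative_iff_has_vector_derivative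
    by (rule einterval_antiderivative[OF lt]) (auto intro!: continuous_intros isCont_radius)
  then obtain F where F: "\<And>x. - (pi / 4) < x \<Longrightarrow> x < 3 * pi / 4 \<Longrightarrow>
      (F has_real_derivative radius x ^ 2) (at x)" by auto
  have "time_map p (\<lambda>x. F x - F 0)"
    by unfold_locales (auto intro!: derivative_eq_intros F)
  then show ?thesis using that by fastforce
qed

end

theorem theorem6:
  fixes p :: nat
  assumes "p > 2" and "odd p"
  shows "\<exists>s c. solution_pair p {- B_const p <..< A_const p + B_const p} s c \<and>
           (\<forall>J. is_interval J \<and> {- B_const p <..< A_const p + B_const p} \<subset> J \<longrightarrow>
              \<not> extends_to p {- B_const p <..< A_const p + B_const p} s c J)"
proof -
  interpret odd_exponent p using assms by unfold_locales
  obtain T where T: "time_map p T" "T 0 = 0" by (rule time_map_exists)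
  interpret time_map p T by (rule T(1))
  show ?thesis
    using solution_pair_angle[OF T(2)] not_extends_to_angle[OF T(2)] by blast
qed

end
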